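(* Let $b\in\{N,D\}$ and $\delta=\max_{1\le i\le N}\frac{\log\mu_i}{\log((\mu_ir_i)^\gamma)}$. Then there exists a constant $\bar C_2>0$ such that for all $k\in\mathbb N$ $$\|\varphi_k^b\|_\infty\le\bar C_2\,(\lambda_k^b)^{\frac{\gamma}{2}\delta}.$$
   Context: Let $N\ge 2$ and $S_i:[0,1]\to[0,1]$, $S_i(x)=r_ix+b_i$, $0<r_i<1$, $0\le b_i\le 1-r_i$, $i=1,\dots,N$, with $0=S_1(0)<S_1(1)\le S_2(0)<S_2(1)\le\dots<S_N(1)=1$. Let $\mu_1,\dots,\mu_N\in(0,1)$ with $\sum_{i=1}^N\mu_i=1$. $\mu$ is the unique Borel probability measure on $[0,1]$ with $\mu(A)=\sum_{i=1}^N\mu_i\,\mu(S_i^{-1}(A))$ for all Borel sets $A\subseteq[0,1]$. The spectral exponent $\gamma$ is the unique solution of $\sum_{i=1}^N(\mu_ir_i)^\gamma=1$. $\mathcal H=L^2([0,1],\mu)$. $\mathcal D_\mu^2$ is the set of $f\in C^1((0,1))\cap C^0([0,1])$ for which there is $(f')^\mu\in \mathcal L^2([0,1],\mu)$ with $f'(x)=f'(0)+\int_0^x(f')^\mu\,d\mu$, $x\in[0,1]$; one sets $\Delta_\mu f=(f')^\mu$. The Neumann operator $\Delta_\mu^N$ (resp. Dirichlet operator $\Delta_\mu^D$) is the restriction of $\Delta_\mu$ to the elements of $\mathcal H$ having a representative $f\in\mathcal D_\mu^2$ with $f'(0)=f'(1)=0$ (resp. $f(0)=f(1)=0$). (The superscripts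 $N$, $D$ denote the boundary condition; $N$ is also the number of maps.) $-\Delta_\mu^b$ is non-negative and self-adjoint on $\mathcal H$, and there is an orthonormal basis $\{\varphi_k^b:k\in\mathbb N\}$ of $\mathcal H$ consisting of $\mathcal H$-normed eigenfunctions of $-\Delta_\mu^b$, with the related eigenvalues in ascending order $0\le\lambda_1^b\le\lambda_2^b\le\dots$, where $\lambda_1^D>0$. $\|f\|_\infty=\operatorname{ess\,sup}_{x\in[0,1]}|f(x)|$; the estimate also holds for the supremum of the representative of $\varphi_k^b$ in $\mathcal D_\mu^2$.
   Formalization: The case b = N, k = 1 is excluded: there the eigenvalue is 0 and the normed eigenfunction is the constant 1 or -1, so the claimed bound would read 1 ≤ 0; all k ≥ 1 for b = D and all k ≥ 2 for b = N are covered. *)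

theory Defs
  imports "HOL-Probability.Probability"
begin

definition ifs_map :: "(nat \<Rightarrow> real) \<Rightarrow> (nat \<Rightarrow> real) \<Rightarrow> nat \<Rightarrow> real \<Rightarrow> real" where
  "ifs_map r b i x = r i * x + b i"

text \<open>The maps and the weights are indexed by \<open>{1..N}\<close>; values at other indices are irrelevant.\<close>

definition ifs :: "nat \<Rightarrow> (nat \<Rightarrow> real) \<Rightarrow> (nat \<Rightarrow> real) \<Rightarrow> bool" where
  "ifs N r b \<longleftrightarrow>
     N \<ge> 2 \<and>
     (\<forall>i\<in>{1..N}. 0 < r i \<and> r i < 1 \<and> 0 \<le> b i \<and> b i \<le> 1 - r i) \<and>
     ifs_map r b 1 0 = 0 \<and>
     (\<forall>i\<in>{1..N}. ifs_map r b i 0 < ifs_map r b i 1) \<and>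
     (\<forall>i\<in>{1..<N}. ifs_map r b i 1 \<le> ifs_map r b (Suc i) 0) \<and>
     ifs_map r b N 1 = 1"

definition weights :: "nat \<Rightarrow> (nat \<Rightarrow> real) \<Rightarrow> bool" where
  "weights N m \<longleftrightarrow> (\<forall>i\<in>{1..N}. 0 < m i \<and> m i < 1) \<and> (\<Sum>i=1..N. m i) = 1"

definition self_similar_measure ::
    "nat \<Rightarrow> (nat \<Rightarrow> real) \<Rightarrow> (nat \<Rightarrow> real) \<Rightarrow> (nat \<Rightarrow> real) \<Rightarrow> real measure \<Rightarrow> bool" where
  "self_similar_measure N r b m M \<longleftrightarrow>
     sets M = sets (restrict_space borel {0..1}) \<and> prob_space M \<and>
     (\<forall>A\<in>sets M. measure M A = (\<Sum>i=1..N. m i * measure M (ifs_map r b i -` A \<inter> {0..1})))"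

definition spectral_exponent ::
    "nat \<Rightarrow> (nat \<Rightarrow> real) \<Rightarrow> (nat \<Rightarrow> real) \<Rightarrow> real \<Rightarrow> bool" where
  "spectral_exponent N r m \<gamma> \<longleftrightarrow> (\<Sum>i=1..N. (m i * r i) powr \<gamma>) = 1"

text \<open>Elements of \<open>L\<^sup>2\<close> are handled through square-integrable functions, equality in
  \<open>L\<^sup>2\<close> being equality almost everywhere. As the space of \<open>M\<close> is \<open>{0..1}\<close>, values outside the
  unit interval play no role.\<close>

definition L2 :: "real measure \<Rightarrow> (real \<Rightarrow> real) set" where
  "L2 M = {u. u \<in> borel_measurable M \<and> integrable M (\<lambda>x. (u x)\<^sup>2)}"

definition inner_L2 :: "real measure \<Rightarrow> (real \<Rightarrow> real) \<Rightarrow> (real \<Rightarrow> real) \<Rightarrow> real" where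
  "inner_L2 M u v = (LINT x|M. u x * v x)"

definition norm_L2 :: "real measure \<Rightarrow> (real \<Rightarrow> real) \<Rightarrow> real" where
  "norm_L2 M u = sqrt (inner_L2 M u u)"

text \<open>\<open>mu_laplacian M f f' g\<close>: \<open>f\<close> belongs to the domain of the measure-geometric Laplacian,
  \<open>f'\<close> is its derivative (one-sided at the end points) and \<open>g\<close> is the \<open>M\<close>-derivative of \<open>f'\<close>.\<close>

definition mu_laplacian ::
    "real measure \<Rightarrow> (real \<Rightarrow> real) \<Rightarrow> (real \<Rightarrow> real) \<Rightarrow> (real \<Rightarrow> real) \<Rightarrow> bool" where
  "mu_laplacian M f f' g \<longleftrightarrow>
     continuous_on {0..1} f \<and>
     (\<forall>x\<in>{0..1}. (f has_real_derivative f' x) (at x within {0..1})) \<and>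
     continuous_on {0<..<1} f' \<and>
     g \<in> L2 M \<and>
     (\<forall>x\<in>{0..1}. f' x = f' 0 + (LINT y:{0..x}|M. g y))"

datatype bdry = Neumann | Dirichlet

fun bdry_cond :: "bdry \<Rightarrow> (real \<Rightarrow> real) \<Rightarrow> (real \<Rightarrow> real) \<Rightarrow> bool" where
  "bdry_cond Neumann f f' \<longleftrightarrow> f' 0 = 0 \<and> f' 1 = 0"
| "bdry_cond Dirichlet f f' \<longleftrightarrow> f 0 = 0 \<and> f 1 = 0"

text \<open>The graph of the Laplacian with boundary condition as an unbounded operator on \<open>L\<^sup>2\<close>:
  \<open>u\<close> lies in the domain and is mapped to \<open>v\<close>.\<close>

definition laplace_op :: "real measure \<Rightarrow> bdry \<Rightarrow> (real \<Rightarrow> real) \<Rightarrow> (real \<Rightarrow> real) \<Rightarrow> bool" where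
  "laplace_op M bc u v \<longleftrightarrow> u \<in> L2 M \<and> v \<in> L2 M \<and>
     (\<exists>f f' g. mu_laplacian M f f' g \<and> bdry_cond bc f f' \<and>
        (AE x in M. u x = f x) \<and> (AE x in M. v x = g x))"

definition eigenfunction :: "real measure \<Rightarrow> bdry \<Rightarrow> real \<Rightarrow> (real \<Rightarrow> real) \<Rightarrow> bool" where
  \<comment> \<open>for the negative Laplacian\<close>
  "eigenfunction M bc l u \<longleftrightarrow>
     \<not> (AE x in M. u x = 0) \<and> laplace_op M bc u (\<lambda>x. - (l * u x))"

text \<open>Orthonormal bases indexed by the positive integers: an orthonormal system whose linear
  span is dense.\<close>

definition orthonormal_basis :: "real measure \<Rightarrow> (nat \<Rightarrow> real \<Rightarrow> real) \<Rightarrow> bool" where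
  "orthonormal_basis M \<phi> \<longleftrightarrow>
     (\<forall>k\<ge>1. \<phi> k \<in> L2 M) \<and>
     (\<forall>j\<ge>1. \<forall>k\<ge>1. inner_L2 M (\<phi> j) (\<phi> k) = (if j = k then 1 else 0)) \<and>
     (\<forall>u\<in>L2 M. \<forall>\<epsilon>>0. \<exists>n c. norm_L2 M (\<lambda>x. u x - (\<Sum>k=1..n. c k * \<phi> k x)) < \<epsilon>)"

definition eigenbasis ::
    "real measure \<Rightarrow> bdry \<Rightarrow> (nat \<Rightarrow> real) \<Rightarrow> (nat \<Rightarrow> real \<Rightarrow> real) \<Rightarrow> bool" where
  "eigenbasis M bc l \<phi> \<longleftrightarrow>
     orthonormal_basis M \<phi> \<and>
     (\<forall>k\<ge>1. eigenfunction M bc (l k) (\<phi> k)) \<and>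
     (\<forall>j\<ge>1. \<forall>k\<ge>j. l j \<le> l k)"

definition sup_norm :: "real measure \<Rightarrow> (real \<Rightarrow> real) \<Rightarrow> ereal" where
  "sup_norm M u = esssup M (\<lambda>x. ereal \<bar>u x\<bar>)"

definition growth_exponent ::
    "nat \<Rightarrow> (nat \<Rightarrow> real) \<Rightarrow> (nat \<Rightarrow> real) \<Rightarrow> real \<Rightarrow> real" where
  "growth_exponent N r m \<gamma> = Max ((\<lambda>i. ln (m i) / ln ((m i * r i) powr \<gamma>)) ` {1..N})"

end

theory Submission
  imports Defs
begin

text \<open>
  The proof balances the oscillation of an eigenfunction against its mass on a single cell of the
  self-similar structure.

  Let \<open>f\<close> be a normed eigenfunction with eigenvalue \<open>\<lambda>\<close>. Integration by parts shows
  \<open>\<integral> (f')\<^sup>2 = \<lambda>\<close> for both boundary conditions (\<open>green_identity\<close>), so that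
  \<open>(f x - f y)\<^sup>2 \<le> \<lambda> \<bar>x - y\<bar>\<close> (\<open>eigenfunction_representative\<close>). Let \<open>x\<close> lie in a cell of
  length \<open>h\<close> and of measure at least \<open>p\<close>, where \<open>h\<close> and \<open>p\<close> are products of contraction ratios and
  weights over the same word. Averaging over this cell gives \<open>(f x)\<^sup>2 \<le> 2 / p + 2 \<lambda> h\<close>. The two
  terms are of the same order if \<open>p h\<close> is comparable to \<open>1 / \<lambda>\<close>, and then \<open>(f x)\<^sup>2 \<le> 4 / p\<close>
  (\<open>square_le_if_good_cell\<close>). Subdividing until \<open>p h\<close> falls to the scale \<open>1 / \<lambda>\<close> produces such a
  cell around almost every point (\<open>AE_good_cell\<close>).

  The exponent \<open>\<delta>\<close> is made for the last step: it satisfies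
  \<open>(m i * r i) powr (\<gamma> * \<delta>) \<le> m i\<close> for each map, hence \<open>(p * h) powr (\<gamma> * \<delta>) \<le> p\<close> for
  each cell by multiplication. So \<open>1 / p\<close> is at most a constant times \<open>\<lambda> powr (\<gamma> * \<delta>)\<close>, and a
  square root is the claim.

  The eigenvalues in question are bounded away from zero (\<open>eigenvalue_pos\<close>), which lets one
  constant serve for the eigenvalues below \<open>1\<close> as well.
\<close>

section \<open>Energy of eigenfunctions\<close>

lemma space_if_sets_unit_interval:
  fixes M :: "real measure"
  assumes "sets M = sets (restrict_space borel {0..1})"
  shows "space M = {0..1}"
  using sets_eq_imp_space_eq[OF assms] by (simp add: space_restrict_space)

lemma continuous_on_unit_interval_bounded:
  fixes f :: "real \<Rightarrow> real"
  assumes "continuous_on {0..1} f"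
  obtains C where "\<And>x. x \<in> {0..1} \<Longrightarrow> \<bar>f x\<bar> \<le> C"
  using compact_imp_bounded[OF compact_continuous_image[OF assms compact_Icc]]
  unfolding bounded_iff real_norm_def by blast

lemma measurable_if_continuous_on_unit_interval:
  fixes f :: "real \<Rightarrow> real"
  assumes "sets M = sets (restrict_space borel {0..1})" "continuous_on {0..1} f"
  shows "f \<in> borel_measurable M"
  using borel_measurable_continuous_on_restrict[OF assms(2)]
    measurable_cong_sets[OF assms(1) refl, of borel] by blast

text \<open>Lebesgue integration of \<open>f'\<close> and of its square requires measurability and boundedness. Both
  are read off from the formula of \<open>f'\<close> as a primitive, which is known on the unit interval only;
  hence the indicator.\<close>

lemma measurable_and_bounded_primitive:
  fixes f' g :: "real \<Rightarrow> real"
  assumes M: "sets M = sets (restrict_space borel {0..1})" "finite_measure M"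
    and g: "integrable M g"
    and f': "\<And>x. x \<in> {0..1} \<Longrightarrow> f' x = c + (LINT y:{0..x}|M. g y)"
  shows "(\<lambda>x. indicator {0..1} x * f' x) \<in> borel_measurable borel"
    and "\<And>x. x \<in> {0..1} \<Longrightarrow> \<bar>f' x\<bar> \<le> \<bar>c\<bar> + (LINT y|M. \<bar>g y\<bar>)"
proof -
  interpret finite_measure M by fact
  have sp: "space M = {0..1}" by (rule space_if_sets_unit_interval[OF M(1)])
  have id: "(\<lambda>y. y) \<in> borel_measurable M"
    by (intro measurable_if_continuous_on_unit_interval M(1) continuous_intros)
  have [measurable]: "g \<in> borel_measurable M" using g by auto
  have m2[measurable]: "snd \<in> borel_measurable (borel \<Otimes>\<^sub>M M)"
    using measurable_compose[OF measurable_snd id, of borel] by (simp add: comp_def)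
  have "(\<lambda>x. LINT y|M. (if y \<le> x then g y else 0)) \<in> borel_measurable borel"
    by (rule borel_measurable_lebesgue_integral) (simp add: split_beta, measurable)
  hence "(\<lambda>x. indicator {0..1} x * (c + (LINT y|M. (if y \<le> x then g y else 0)))) \<in> borel_measurable borel"
    by measurable
  moreover have "(LINT y:{0..x}|M. g y) = (LINT y|M. (if y \<le> x then g y else 0))" for x
    unfolding set_lebesgue_integral_def by (intro Bochner_Integration.integral_cong refl) (auto simp: sp indicator_def)
  hence "indicator {0..1} x * f' x = indicator {0..1} x * (c + (LINT y|M. (if y \<le> x then g y else 0)))" for x
    using f'[of x] by (auto simp: indicator_def)
  ultimately show "(\<lambda>x. indicator {0..1} x * f' x) \<in> borel_measurable borel" by presburger
  fix x :: real assume x: "x \<in> {0..1}"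
  have "\<bar>LINT y:{0..x}|M. g y\<bar> \<le> (LINT y|M. \<bar>g y\<bar>)"
    unfolding set_lebesgue_integral_def
    by (rule integral_abs_bound[THEN order_trans], rule integral_mono_AE')
       (use g in \<open>auto simp: indicator_def\<close>)
  thus "\<bar>f' x\<bar> \<le> \<bar>c\<bar> + (LINT y|M. \<bar>g y\<bar>)" using f'[OF x] by linarith
qed

text \<open>The last two conclusions are the fundamental theorem of calculus and Green's first identity.
  The latter comes from Fubini's theorem: insert the formula for \<open>f'\<close> for one of the two factors
  of \<open>(f' x)\<^sup>2\<close> and integrate over \<open>x\<close> first. The other factor then contributes its integral
  over \<open>{y..1}\<close>, which is \<open>f 1 - f y\<close>.\<close>

lemma green_identity:
  fixes f f' g :: "real \<Rightarrow> real"
  assumes M: "sets M = sets (restrict_space borel {0..1})" "finite_measure M"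
    and deriv: "\<And>x. x \<in> {0..1} \<Longrightarrow> (f has_real_derivative f' x) (at x within {0..1})"
    and g: "integrable M g"
    and f': "\<And>x. x \<in> {0..1} \<Longrightarrow> f' x = f' 0 + (LINT y:{0..x}|M. g y)"
  shows "set_integrable lborel {0..1} f'"
    and "set_integrable lborel {0..1} (\<lambda>x. (f' x)\<^sup>2)"
    and "\<And>x y. \<lbrakk>0 \<le> x; x \<le> y; y \<le> 1\<rbrakk> \<Longrightarrow> (LINT t:{x..y}|lborel. f' t) = f y - f x"
    and "(LINT x:{0..1}|lborel. (f' x)\<^sup>2) = f 1 * f' 1 - f 0 * f' 0 - (LINT y|M. g y * f y)"
proof -
  interpret finite_measure M by fact
  interpret P: pair_sigma_finite lborel M by standard
  have sp: "space M = {0..1}" by (rule space_if_sets_unit_interval[OF M(1)])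
  have cf: "continuous_on {0..1} f" using deriv DERIV_continuous_on by blast
  have fM[measurable]: "f \<in> borel_measurable M" 
    by (rule measurable_if_continuous_on_unit_interval[OF M(1) cf])
  have [measurable]: "g \<in> borel_measurable M" using g by auto
  define B where "B = \<bar>f' 0\<bar> + (LINT y|M. \<bar>g y\<bar>)"
  define p where "p x = indicator {0..1} x * f' x" for x
  have p[measurable]: "p \<in> borel_measurable borel"
    using measurable_and_bounded_primitive(1)[OF M g f'] unfolding p_def .
  have B: "\<bar>f' x\<bar> \<le> B" if "x \<in> {0..1}" for x
    using measurable_and_bounded_primitive(2)[OF M g f'] that unfolding B_def by simp
  have pB: "\<bar>p x\<bar> \<le> indicator {0..1} x * B" for x using B[of x] by (auto simp: p_def indicator_def)
  have intB: "integrable lborel (\<lambda>x::real. indicator {0..1} x * C)" for C :: real by simp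
  have pint: "integrable lborel p"
    by (rule Bochner_Integration.integrable_bound[OF intB[of B]]) (use pB in \<open>auto intro: order_trans[OF _ abs_ge_self]\<close>)
  show f'int: "set_integrable lborel {0..1} f'"
    using pint by (simp add: set_integrable_def p_def[abs_def])
  have psq: "indicator {0..1} x * (f' x)\<^sup>2 = p x * p x" for x by (auto simp: p_def indicator_def power2_eq_square)
  have ppB: "\<bar>p x * p x\<bar> \<le> indicator {0..1} x * (B*B)" for x
  proof (cases "x \<in> {0..1}")
    case True
    have "\<bar>f' x\<bar> * \<bar>f' x\<bar> \<le> B * B"
      using B[OF True] by (intro mult_mono) auto
    thus ?thesis using True by (simp add: p_def abs_mult)
  qed (simp add: p_def)
  have ppint: "integrable lborel (\<lambda>x. p x * p x)"
    by (rule Bochner_Integration.integrable_bound[OF intB[of "B*B"]]) (use ppB in \<open>auto intro: order_trans[OF _ abs_ge_self]\<close>)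
  thus "set_integrable lborel {0..1} (\<lambda>x. (f' x)\<^sup>2)"
    by (simp add: set_integrable_def psq)
  have ftc: "(LINT t:{x..y}|lborel. f' t) = f y - f x" if "0 \<le> x" "x \<le> y" "y \<le> 1" for x y
  proof -
    have "(f' has_integral (f y - f x)) {x..y}"
    proof (rule fundamental_theorem_of_calculus[OF \<open>x \<le> y\<close>])
      fix t assume "t \<in> {x..y}"
      hence "(f has_real_derivative f' t) (at t within {0..1})" using deriv that by simp
      hence "(f has_real_derivative f' t) (at t within {x..y})"
        by (rule DERIV_subset) (use that in auto)
      thus "(f has_vector_derivative f' t) (at t within {x..y})"
        by (simp add: has_real_derivative_iff_has_vector_derivative)
    qed
    thus ?thesis
      using set_borel_integral_eq_integral(2)[OF set_integrable_subset[OF f'int, of "{x..y}"]] that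
      by (auto simp: integral_unique)
  qed
  show "\<And>x y. \<lbrakk>0 \<le> x; x \<le> y; y \<le> 1\<rbrakk> \<Longrightarrow> (LINT t:{x..y}|lborel. f' t) = f y - f x" by (rule ftc)

  \<comment> \<open>The integrand of the double integral, with \<open>p\<close> the extension of \<open>f'\<close> by zero.\<close>
  define F where "F x y = (if y \<le> x then p x * g y else 0)" for x y
  have m2[measurable]: "snd \<in> borel_measurable (lborel \<Otimes>\<^sub>M M)"
  proof -
    have id: "(\<lambda>y. y) \<in> borel_measurable M"
      by (intro measurable_if_continuous_on_unit_interval M(1) continuous_intros)
    show ?thesis
      using measurable_compose[OF measurable_snd id, of lborel] by (simp add: comp_def)
  qed
  have FX: "(LINT y|M. F x y) = p x * p x - f' 0 * p x" for x
  proof (cases "x \<in> {0..1}")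
    case True
    have "(LINT y|M. F x y) = (LINT y|M. p x * (indicator {0..x} y *\<^sub>R g y))"
      by (intro Bochner_Integration.integral_cong refl) (use sp in \<open>auto simp: F_def indicator_def\<close>)
    also have "\<dots> = p x * (f' x - f' 0)"
      using f'[OF True] by (simp add: set_lebesgue_integral_def)
    finally show ?thesis using True by (simp add: p_def algebra_simps)
  next
    case False
    hence 0: "p x = 0" by (auto simp: p_def)
    hence "F x y = 0" for y by (simp add: F_def)
    thus ?thesis using 0 by simp
  qed
  have FY: "(LINT x|lborel. F x y) = g y * (f 1 - f y)" if y: "y \<in> {0..1}" for y
  proof -
    have "(LINT x|lborel. F x y) = (LINT x|lborel. g y * (indicator {y..1} x *\<^sub>R f' x))"
      by (intro Bochner_Integration.integral_cong refl) (use y in \<open>auto simp: F_def p_def indicator_def\<close>)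
    also have "\<dots> = g y * (f 1 - f y)"
      using ftc[of y 1] y by (simp add: set_lebesgue_integral_def)
    finally show ?thesis .
  qed
  have Fm[measurable]: "case_prod F \<in> borel_measurable (lborel \<Otimes>\<^sub>M M)"
    unfolding F_def split_beta by measurable
  have Fint: "integrable (lborel \<Otimes>\<^sub>M M) (case_prod F)"
  proof (rule P.Fubini_integrable[OF Fm])
    have le: "\<bar>LINT y|M. norm (F x y)\<bar> \<le> \<bar>p x\<bar> * (LINT y|M. \<bar>g y\<bar>)" for x
    proof -
      have "(LINT y|M. norm (F x y)) \<le> (LINT y|M. \<bar>p x\<bar> * \<bar>g y\<bar>)"
        by (rule integral_mono_AE') (use g in \<open>auto simp: F_def abs_mult\<close>)
      moreover have "(LINT y|M. norm (F x y)) \<ge> 0" by simp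
      ultimately show ?thesis by simp
    qed
    show "integrable lborel (\<lambda>x. LINT y|M. norm (case_prod F (x, y)))"
      by (rule Bochner_Integration.integrable_bound[of _ "\<lambda>x. \<bar>p x\<bar> * (LINT y|M. \<bar>g y\<bar>)"])
         (use pint le in \<open>auto intro!: AE_I2 intro: order_trans[OF _ abs_ge_self]\<close>)
    show "AE x in lborel. integrable M (\<lambda>y. case_prod F (x, y))"
    proof (intro AE_I2)
      fix x
      have Fx: "(\<lambda>y. F x y) \<in> borel_measurable M"
        using measurable_compose[OF measurable_Pair1' Fm, of x] by simp
      have "integrable M (\<lambda>y. F x y)"
      proof (rule Bochner_Integration.integrable_bound[OF _ Fx])
        show "integrable M (\<lambda>y. p x * g y)" using g by simp
      qed (simp add: F_def)
      thus "integrable M (\<lambda>y. case_prod F (x, y))" by simp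
    qed
  qed
  have gf: "integrable M (\<lambda>y. g y * f y)"
  proof -
    obtain C where C: "\<And>x. x \<in> {0..1} \<Longrightarrow> \<bar>f x\<bar> \<le> C"
      using continuous_on_unit_interval_bounded[OF cf] by blast
    have C0: "C \<ge> 0" using C[of 0] by auto
    show ?thesis
      by (rule Bochner_Integration.integrable_bound[of _ "\<lambda>y. C * g y"])
         (use g C C0 in \<open>auto intro!: AE_I2 simp: abs_mult sp mult.commute[of C] intro: mult_left_mono\<close>)
  qed
  have "(LINT x:{0..1}|lborel. (f' x)\<^sup>2) - f' 0 * (f 1 - f 0) = (LINT x|lborel. p x * p x - f' 0 * p x)"
  proof -
    have "(LINT x|lborel. p x) = f 1 - f 0"
      using ftc[of 0 1] by (simp add: set_lebesgue_integral_def p_def)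
    moreover have "(LINT x:{0..1}|lborel. (f' x)\<^sup>2) = (LINT x|lborel. p x * p x)"
      by (simp add: set_lebesgue_integral_def psq)
    ultimately show ?thesis using pint ppint by simp
  qed
  also have "\<dots> = (LINT y|M. LINT x|lborel. F x y)"
    using P.Fubini_integral[OF Fint] by (simp add: FX)
  also have "\<dots> = (LINT y|M. g y * f 1 - g y * f y)"
    by (intro Bochner_Integration.integral_cong refl) (simp add: FY sp algebra_simps)
  also have "\<dots> = (LINT y|M. g y) * f 1 - (LINT y|M. g y * f y)"
    using g gf by simp
  also have "(LINT y|M. g y) = f' 1 - f' 0"
  proof -
    have "(LINT y|M. g y) = (LINT y:{0..1}|M. g y)"
      unfolding set_lebesgue_integral_def
      by (intro Bochner_Integration.integral_cong refl) (auto simp: sp)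
    thus ?thesis using f'[of 1] by simp
  qed
  finally show "(LINT x:{0..1}|lborel. (f' x)\<^sup>2) = f 1 * f' 1 - f 0 * f' 0 - (LINT y|M. g y * f y)"
    by (simp add: algebra_simps)
qed

text \<open>The Cauchy-Schwarz inequality against the constant \<open>1\<close>, obtained from the nonnegativity of the
  variance of \<open>f'\<close> over the interval.\<close>

lemma square_increment_le_energy:
  fixes f f' :: "real \<Rightarrow> real"
  assumes xy: "x \<le> y"
    and i1: "set_integrable lborel {x..y} f'"
    and i2: "set_integrable lborel {x..y} (\<lambda>t. (f' t)\<^sup>2)"
  shows "(LINT t:{x..y}|lborel. f' t)\<^sup>2 \<le> (y - x) * (LINT t:{x..y}|lborel. (f' t)\<^sup>2)"
proof (cases "x = y")
  case True
  have "(LINT t:{x..y}|lborel. f' t) = 0"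
    using set_borel_integral_eq_integral(2)[OF i1] True by simp
  thus ?thesis using True by simp
next
  case False
  hence d: "y - x > 0" using xy by simp
  define c where "c = (LINT t:{x..y}|lborel. f' t) / (y - x)"
  have one: "set_integrable lborel {x..y} (\<lambda>t. a)" for a :: real
    unfolding set_integrable_def by (intro integrable_scaleR_left integrable_real_indicator) (use xy in auto)
  have "0 \<le> (LINT t:{x..y}|lborel. (f' t - c)\<^sup>2)"
    unfolding set_lebesgue_integral_def by (intro Bochner_Integration.integral_nonneg) auto
  also have "\<dots> = (LINT t:{x..y}|lborel. ((f' t)\<^sup>2 - 2 * c * f' t) + c\<^sup>2)"
    by (simp add: power2_diff algebra_simps)
  also have "\<dots> = (LINT t:{x..y}|lborel. (f' t)\<^sup>2) - 2 * c * (LINT t:{x..y}|lborel. f' t) + c\<^sup>2 * (y - x)"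
  proof -
    have i3: "set_integrable lborel {x..y} (\<lambda>t. 2 * c * f' t)" using i1 by simp
    have cc: "(LINT t:{x..y}|lborel. c\<^sup>2) = c\<^sup>2 * (y - x)"
      using xy by (simp add: set_lebesgue_integral_def)
    have *: "set_integrable lborel {x..y} (\<lambda>t. (f' t)\<^sup>2 - 2 * c * f' t)"
      by (rule set_integral_diff(1)[OF i2 i3])
    show ?thesis
      unfolding set_integral_add(2)[OF * one] set_integral_diff(2)[OF i2 i3] cc by simp
  qed
  finally have "0 \<le> (y-x) * ((LINT t:{x..y}|lborel. (f' t)\<^sup>2) - 2 * c * (LINT t:{x..y}|lborel. f' t) + c\<^sup>2 * (y - x))"
    using d by simp
  moreover have I: "(LINT t:{x..y}|lborel. f' t) = c * (y - x)" using d by (simp add: c_def)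
  ultimately show ?thesis unfolding I by (simp add: algebra_simps power2_eq_square)
qed

text \<open>All that the estimate needs to know about an eigenfunction. In Green's identity with
  \<open>g = - l f\<close> either boundary condition kills the boundary terms, so the energy
  \<open>\<integral> (f')\<^sup>2\<close> of a normed eigenfunction is its eigenvalue, and the Cauchy-Schwarz inequality makes
  the representative Hoelder continuous with exponent one half.\<close>

lemma eigenfunction_representative:
  assumes M: "sets M = sets (restrict_space borel {0..1})" "finite_measure M"
    and u: "eigenfunction M bc l u" "inner_L2 M u u = 1"
  obtains f where "continuous_on {0..1} f" "AE x in M. u x = f x" "0 \<le> l"
    "\<And>x y. x \<in> {0..1} \<Longrightarrow> y \<in> {0..1} \<Longrightarrow> (f x - f y)\<^sup>2 \<le> l * \<bar>x - y\<bar>"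
    "bc = Dirichlet \<Longrightarrow> f 0 = 0"
proof -
  interpret finite_measure M by fact
  obtain f f' g where lap: "mu_laplacian M f f' g" and bd: "bdry_cond bc f f'"
    and uf: "AE x in M. u x = f x" and ug: "AE x in M. - (l * u x) = g x"
    using u(1) unfolding eigenfunction_def laplace_op_def by (elim conjE exE) (rule that)
  have cf: "continuous_on {0..1} f"
    and deriv: "\<And>x. x \<in> {0..1} \<Longrightarrow> (f has_real_derivative f' x) (at x within {0..1})"
    and gL2: "g \<in> L2 M"
    and f': "\<And>x. x \<in> {0..1} \<Longrightarrow> f' x = f' 0 + (LINT y:{0..x}|M. g y)"
    using lap unfolding mu_laplacian_def by blast+
  have [measurable]: "u \<in> borel_measurable M"
    using u(1) unfolding eigenfunction_def laplace_op_def L2_def by auto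
  have [measurable]: "f \<in> borel_measurable M"
    by (rule measurable_if_continuous_on_unit_interval[OF M(1) cf])
  have [measurable]: "g \<in> borel_measurable M" using gL2 by (auto simp: L2_def)
  have g: "integrable M g"
    by (rule square_integrable_imp_integrable) (use gL2 in \<open>auto simp: L2_def\<close>)
  have gf: "(LINT y|M. g y * f y) = - l"
  proof -
    have "(LINT y|M. g y * f y) = (LINT y|M. - l * (u y * u y))"
    proof (rule integral_cong_AE)
      show "AE y in M. g y * f y = - l * (u y * u y)"
        using uf ug by eventually_elim (metis mult.assoc mult_minus_left)
    qed auto
    also have "\<dots> = - l" using u(2) by (simp add: inner_L2_def)
    finally show ?thesis .
  qed
  have green: "set_integrable lborel {0..1} f'" "set_integrable lborel {0..1} (\<lambda>x. (f' x)\<^sup>2)"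
    "\<And>x y. \<lbrakk>0 \<le> x; x \<le> y; y \<le> 1\<rbrakk> \<Longrightarrow> (LINT t:{x..y}|lborel. f' t) = f y - f x"
    "(LINT x:{0..1}|lborel. (f' x)\<^sup>2) = f 1 * f' 1 - f 0 * f' 0 - (LINT y|M. g y * f y)"
    using green_identity[OF M deriv g f'] by simp_all
  have bd0: "f 1 * f' 1 - f 0 * f' 0 = 0" using bd by (cases bc) auto
  have energy: "(LINT x:{0..1}|lborel. (f' x)\<^sup>2) = l"
    using green(4) gf bd0 by simp
  have holder: "(f y - f x)\<^sup>2 \<le> l * (y - x)" if "0 \<le> x" "x \<le> y" "y \<le> 1" for x y
  proof -
    have sub: "{x..y} \<subseteq> {0..1}" using that by auto
    have i1: "set_integrable lborel {x..y} f'" and i2: "set_integrable lborel {x..y} (\<lambda>t. (f' t)\<^sup>2)"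
      using set_integrable_subset[OF green(1) _ sub] set_integrable_subset[OF green(2) _ sub] by auto
    have "(f y - f x)\<^sup>2 \<le> (y - x) * (LINT t:{x..y}|lborel. (f' t)\<^sup>2)"
      using square_increment_le_energy[OF \<open>x \<le> y\<close> i1 i2] green(3)[OF that] by simp
    also have "\<dots> \<le> (y - x) * l"
    proof (rule mult_left_mono)
      show "(LINT t:{x..y}|lborel. (f' t)\<^sup>2) \<le> l"
        unfolding energy[symmetric] set_lebesgue_integral_def
      proof (rule integral_mono_AE')
        show "integrable lborel (\<lambda>t. indicator {0..1} t *\<^sub>R (f' t)\<^sup>2)"
          using green(2) by (simp only: set_integrable_def)
        show "AE t in lborel. indicator {x..y} t *\<^sub>R (f' t)\<^sup>2 \<le> indicator {0..1} t *\<^sub>R (f' t)\<^sup>2"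
          by (intro AE_I2) (use sub in \<open>simp add: indicator_def subset_iff\<close>)
      qed simp
    qed (use that in simp)
    finally show ?thesis by (simp add: mult.commute)
  qed
  show thesis
  proof (rule that[of f])
    show "0 \<le> l" using order_trans[OF zero_le_power2 holder[of 0 1]] by simp
    show "(f x - f y)\<^sup>2 \<le> l * \<bar>x - y\<bar>" if "x \<in> {0..1}" "y \<in> {0..1}" for x y
      using holder[of x y] holder[of y x] that by (cases "x \<le> y") (simp_all add: power2_commute[of "f x"])
    show "bc = Dirichlet \<Longrightarrow> f 0 = 0" using bd by simp
  qed (use cf uf in auto)
qed

section \<open>Cells of a self-similar measure\<close>

lemma ifs_map_mem_unit_interval:
  assumes "ifs N r b" "i \<in> {1..N}" "x \<in> {0..1}"
  shows "ifs_map r b i x \<in> {0..1}"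
proof -
  have r: "0 < r i" and b: "0 \<le> b i" "b i \<le> 1 - r i" using assms(1,2) by (auto simp: ifs_def)
  have "r i * x \<le> r i" using assms(3) r by simp
  moreover have "0 \<le> r i * x" using assms(3) r by simp
  ultimately show ?thesis using b unfolding ifs_map_def atLeastAtMost_iff by linarith
qed

lemma contraction_ratio_and_weight_bounds:
  assumes "ifs N r b" "weights N m" "i \<in> {1..N}"
  shows "0 < r i" "0 < m i" "m i < 1" "0 < m i * r i" "m i * r i < 1"
proof -
  have r: "0 < r i" "r i < 1" using assms(1,3) unfolding ifs_def by blast+
  have m: "0 < m i" "m i < 1" using assms(2,3) unfolding weights_def by blast+
  show "0 < r i" "0 < m i" "m i < 1" "0 < m i * r i" using r m by simp_all
  show "m i * r i < 1" using r m mult_strict_mono[of "m i" 1 "r i" 1] by simp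
qed

text \<open>One term of the self-similarity equation for the image set is \<open>m i\<close> times the measure of \<open>A\<close>. The
  other terms are nonnegative; they need not vanish, since neighbouring images may share an end point.\<close>

lemma self_similar_measure_image_ge:
  assumes ifs: "ifs N r b" and w: "weights N m" and M: "self_similar_measure N r b m M"
    and i: "i \<in> {1..N}" and A: "A \<in> sets M" "ifs_map r b i ` A \<in> sets M"
  shows "m i * measure M A \<le> measure M (ifs_map r b i ` A)"
proof -
  have r: "r i \<noteq> 0" using contraction_ratio_and_weight_bounds(1)[OF ifs w i] by simp
  have sets: "sets M = sets (restrict_space borel {0..1})" using M by (simp add: self_similar_measure_def)
  have "space M = {0..1}" by (rule space_if_sets_unit_interval[OF sets])
  hence "A \<subseteq> {0..1}" using sets.sets_into_space[OF A(1)] by simp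
  moreover have "inj (ifs_map r b i)" using r by (auto simp: inj_def ifs_map_def)
  ultimately have "ifs_map r b i -` (ifs_map r b i ` A) \<inter> {0..1} = A"
    by (auto simp: inj_vimage_image_eq)
  hence "m i * measure M A = m i * measure M (ifs_map r b i -` (ifs_map r b i ` A) \<inter> {0..1})"
    by simp
  also have "\<dots> \<le> (\<Sum>j=1..N. m j * measure M (ifs_map r b j -` (ifs_map r b i ` A) \<inter> {0..1}))"
  proof (rule member_le_sum)
    fix j assume "j \<in> {1..N} - {i}"
    hence "0 < m j" using w by (auto simp: weights_def)
    thus "0 \<le> m j * measure M (ifs_map r b j -` (ifs_map r b i ` A) \<inter> {0..1})" by simp
  qed (use i in auto)
  also have "\<dots> = measure M (ifs_map r b i ` A)"
    using M A(2) by (simp add: self_similar_measure_def)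
  finally show ?thesis .
qed

text \<open>This replaces a description of the support: a property holds almost everywhere once it holds almost
  everywhere on every first-level image. Iterating it reaches cells of every size without any
  symbolic coding of points.\<close>

lemma AE_self_similar_measure:
  assumes ifs: "ifs N r b" and w: "weights N m" and M: "self_similar_measure N r b m M"
    and ae: "\<And>i. i \<in> {1..N} \<Longrightarrow> AE x in M. P (ifs_map r b i x)"
  shows "AE x in M. P x"
proof -
  have sets: "sets M = sets (restrict_space borel {0..1})" and pM: "prob_space M"
    using M by (auto simp: self_similar_measure_def)
  interpret prob_space M by fact
  have sp: "space M = {0..1}" by (rule space_if_sets_unit_interval[OF sets])
  \<comment> \<open>The set where \<open>P\<close> holds need not be measurable, so it is replaced by images of sets of full
    measure.\<close>
  have "\<exists>A\<in>sets M. prob A = 1 \<and> (\<forall>x\<in>A. P (ifs_map r b i x))" if i: "i \<in> {1..N}" for i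
  proof -
    obtain Z where Z: "{x \<in> space M. \<not> P (ifs_map r b i x)} \<subseteq> Z" "emeasure M Z = 0" "Z \<in> sets M"
      using AE_E[OF ae[OF i]] by blast
    have "prob (space M - Z) = 1" using prob_compl[OF Z(3)] Z(2) by (simp add: measure_def)
    thus ?thesis using Z by (intro bexI[of _ "space M - Z"]) auto
  qed
  then obtain A where A: "\<And>i. i \<in> {1..N} \<Longrightarrow> A i \<in> sets M" "\<And>i. i \<in> {1..N} \<Longrightarrow> prob (A i) = 1"
    "\<And>i x. i \<in> {1..N} \<Longrightarrow> x \<in> A i \<Longrightarrow> P (ifs_map r b i x)"
    by metis
  define B where "B = (\<Union>i\<in>{1..N}. ifs_map r b i ` A i)"
  have img: "ifs_map r b i ` A i \<in> sets M" if i: "i \<in> {1..N}" for i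
  proof -
    have r: "r i \<noteq> 0" using contraction_ratio_and_weight_bounds(1)[OF ifs w i] by simp
    have Ab: "A i \<in> sets borel" "A i \<subseteq> {0..1}"
      using A(1)[OF i] by (auto simp: sets sets_restrict_space_iff)
    have "ifs_map r b i ` A i = (\<lambda>y. (y - b i) / r i) -` A i"
    proof safe
      fix y assume "(y - b i) / r i \<in> A i"
      moreover have "y = ifs_map r b i ((y - b i) / r i)" using r by (simp add: ifs_map_def)
      ultimately show "y \<in> ifs_map r b i ` A i" by blast
    qed (use r in \<open>simp add: ifs_map_def\<close>)
    also have "\<dots> \<in> sets borel"
      using measurable_sets[of "\<lambda>y. (y - b i) / r i" borel borel "A i"] Ab(1) by simp
    finally have "ifs_map r b i ` A i \<in> sets borel" .
    moreover have "ifs_map r b i ` A i \<subseteq> {0..1}"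
      using ifs_map_mem_unit_interval[OF ifs i] Ab(2) by blast
    ultimately show ?thesis by (simp add: sets sets_restrict_space_iff)
  qed
  have Bs: "B \<in> sets M" unfolding B_def using img by (intro sets.finite_UN) auto
  have "prob B = (\<Sum>i=1..N. m i * prob (ifs_map r b i -` B \<inter> {0..1}))"
    using M Bs by (simp add: self_similar_measure_def)
  also have "\<dots> \<ge> (\<Sum>i=1..N. m i * 1)"
  proof (intro sum_mono mult_left_mono)
    fix i assume i: "i \<in> {1..N}"
    have "(\<lambda>x. ifs_map r b i x) \<in> borel_measurable borel" unfolding ifs_map_def by measurable
    moreover have "B \<in> sets borel" using Bs by (simp add: sets sets_restrict_space_iff)
    ultimately have "ifs_map r b i -` B \<in> sets borel" using measurable_sets[of "ifs_map r b i" borel borel B] by simp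
    hence "ifs_map r b i -` B \<inter> {0..1} \<in> sets M" by (simp add: sets sets_restrict_space_iff)
    moreover have "A i \<subseteq> ifs_map r b i -` B \<inter> {0..1}"
      using i sets.sets_into_space[OF A(1)[OF i]] unfolding sp B_def by blast
    ultimately show "1 \<le> prob (ifs_map r b i -` B \<inter> {0..1})"
      using finite_measure_mono A(2)[OF i] by metis
    show "0 \<le> m i" using w i by (auto simp: weights_def less_imp_le)
  qed
  also have "(\<Sum>i=1..N. m i * 1) = 1" using w by (simp add: weights_def)
  finally have "prob B = 1" using prob_le_1[of B] by linarith
  hence "AE x in M. x \<in> B" using AE_in_set_eq_1[OF Bs] by simp
  thus ?thesis by eventually_elim (use A(3) in \<open>auto simp: B_def\<close>)
qed

text \<open>In the application \<open>h\<close> and \<open>p\<close> are the products of the contraction ratios and of the weights along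
  a word, and the interval is the image of the unit interval under the corresponding composition of
  maps. What matters of a cell are these inequalities alone; the last one, a lower bound of the
  weight by a power of \<open>p * h\<close>, is multiplicative along words.\<close>

definition good_cell :: "real measure \<Rightarrow> real \<Rightarrow> real \<Rightarrow> real \<Rightarrow> real \<Rightarrow> real \<Rightarrow> bool" where
  "good_cell M s a h p x \<longleftrightarrow>
     0 \<le> a \<and> 0 < h \<and> a + h \<le> 1 \<and> x \<in> {a..a+h} \<and> 0 < p \<and> p \<le> measure M {a..a+h} \<and> (p * h) powr s \<le> p"

lemma good_cell_image:
  assumes ifs: "ifs N r b" and w: "weights N m" and M: "self_similar_measure N r b m M"
    and i: "i \<in> {1..N}" and s: "(m i * r i) powr s \<le> m i"
    and cell: "good_cell M s a h p x"
  shows "good_cell M s (ifs_map r b i a) (r i * h) (m i * p) (ifs_map r b i x)"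
proof -
  note r = contraction_ratio_and_weight_bounds(1)[OF ifs w i]
    and m = contraction_ratio_and_weight_bounds(2)[OF ifs w i]
  have sets: "sets M = sets (restrict_space borel {0..1})" using M by (simp add: self_similar_measure_def)
  note c = cell[unfolded good_cell_def]
  have img: "ifs_map r b i ` {a..a+h} = {ifs_map r b i a..ifs_map r b i a + r i * h}"
    using c r image_affinity_atLeastAtMost[of "r i" "b i" a "a+h"]
    by (simp add: ifs_map_def[abs_def] algebra_simps)
  have a1: "ifs_map r b i a \<in> {0..1}" "ifs_map r b i (a+h) \<in> {0..1}"
    using c by (intro ifs_map_mem_unit_interval[OF ifs i]; simp)+
  have ah: "ifs_map r b i (a+h) = ifs_map r b i a + r i * h" by (simp add: ifs_map_def algebra_simps)
  have "m i * p \<le> m i * measure M {a..a+h}" using c m by simp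
  also have "\<dots> \<le> measure M (ifs_map r b i ` {a..a+h})"
    using a1 c
    by (intro self_similar_measure_image_ge[OF ifs w M i]) (auto simp: img sets sets_restrict_space_iff ah)
  finally have "m i * p \<le> measure M {ifs_map r b i a..ifs_map r b i a + r i * h}" by (simp add: img)
  moreover have "(m i * p * (r i * h)) powr s \<le> m i * p"
  proof -
    have "m i * p * (r i * h) = (m i * r i) * (p * h)" by simp
    hence "(m i * p * (r i * h)) powr s = (m i * r i) powr s * (p * h) powr s"
      using c m r by (simp only: powr_mult)
    also have "\<dots> \<le> m i * p" using s c m by (intro mult_mono) auto
    finally show ?thesis .
  qed
  moreover have "ifs_map r b i x \<in> {ifs_map r b i a..ifs_map r b i a + r i * h}"
    using c img by blast
  ultimately show ?thesis using a1 ah c m r by (simp add: good_cell_def)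
qed

text \<open>A stopping-time partition of scale \<open>t\<close>: subdivide until \<open>p * h\<close> has dropped to at most \<open>t\<close>. One
  subdivision multiplies \<open>p * h\<close> by some \<open>m i * r i\<close>, so the last step takes it below \<open>t\<close>
  by no more than the factor \<open>c\<close>. Subdividing the cell of a point \<open>ifs_map r b i x\<close> at scale \<open>t\<close>
  amounts to subdividing that of \<open>x\<close> at scale \<open>t / (m i * r i)\<close>, and the power of \<open>q\<close> bounds the number of subdivisions.\<close>

lemma AE_good_cell_power:
  assumes ifs: "ifs N r b" and w: "weights N m" and M: "self_similar_measure N r b m M"
    and s: "\<And>i. i \<in> {1..N} \<Longrightarrow> (m i * r i) powr s \<le> m i"
    and c: "c \<le> 1" "\<And>i. i \<in> {1..N} \<Longrightarrow> c \<le> m i * r i"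
    and q: "\<And>i. i \<in> {1..N} \<Longrightarrow> m i * r i \<le> q"
    and t: "q ^ n \<le> t" "0 < t" "t \<le> 1"
  shows "AE x in M. \<exists>a h p. good_cell M s a h p x \<and> c * t \<le> p * h \<and> p * h \<le> t"
proof -
  have sets: "sets M = sets (restrict_space borel {0..1})" and pM: "prob_space M"
    using M by (auto simp: self_similar_measure_def)
  interpret prob_space M by fact
  have sp: "space M = {0..1}" by (rule space_if_sets_unit_interval[OF sets])
  have unit: "good_cell M s 0 1 1 x" if "x \<in> {0..1}" for x
    using that prob_space by (simp add: good_cell_def sp)
  show ?thesis
    using t
  proof (induction n arbitrary: t)
    case (0 t)
    show ?case using 0 c(1) sp unit
      by (intro AE_I2 exI[of _ 0] exI[of _ 1]) auto
  next
    case (Suc n t)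
    show ?case
    proof (rule AE_self_similar_measure[OF ifs w M])
      fix i assume i: "i \<in> {1..N}"
      have k: "0 < m i * r i" by (rule contraction_ratio_and_weight_bounds(4)[OF ifs w i])
      note image = good_cell_image[OF ifs w M i s[OF i]]
      show "AE x in M. \<exists>a h p. good_cell M s a h p (ifs_map r b i x) \<and> c * t \<le> p * h \<and> p * h \<le> t"
      proof (cases "t \<le> m i * r i")
        case True
        define t' where "t' = t / (m i * r i)"
        have tt': "t = (m i * r i) * t'"
          unfolding t'_def using k by (metis less_irrefl nonzero_mult_div_cancel_left times_divide_eq_right)
        have "m i * r i * q ^ n \<le> q * q ^ n"
          using q[OF i] k by (intro mult_right_mono zero_le_power) auto
        also have "\<dots> \<le> m i * r i * t'" using Suc.prems tt' by simp
        finally have "q ^ n \<le> t'" using mult_le_cancel_left_pos[OF k] by simp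
        moreover have "0 < t'" "t' \<le> 1" using True k Suc.prems by (auto simp: t'_def)
        ultimately have "AE x in M. \<exists>a h p. good_cell M s a h p x \<and> c * t' \<le> p * h \<and> p * h \<le> t'"
          by (rule Suc.IH)
        thus ?thesis
        proof eventually_elim
          fix x assume "\<exists>a h p. good_cell M s a h p x \<and> c * t' \<le> p * h \<and> p * h \<le> t'"
          then obtain a h p where ahp: "good_cell M s a h p x" "c * t' \<le> p * h" "p * h \<le> t'" by blast
          have "c * t \<le> m i * p * (r i * h)" "m i * p * (r i * h) \<le> t"
            using mult_left_mono[OF ahp(2), of "m i * r i"] mult_left_mono[OF ahp(3), of "m i * r i"] k
            by (simp_all add: tt' ac_simps)
          thus "\<exists>a h p. good_cell M s a h p (ifs_map r b i x) \<and> c * t \<le> p * h \<and> p * h \<le> t"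
            using image[OF ahp(1)] by blast
        qed
      next
        case False
        have "c * t \<le> m i * r i"
        proof (cases "0 \<le> c")
          case True
          hence "c * t \<le> c * 1" using Suc.prems by (intro mult_left_mono) auto
          thus ?thesis using c(2)[OF i] by linarith
        next
          case False
          hence "c * t \<le> 0" using Suc.prems by (simp add: mult_nonpos_nonneg)
          thus ?thesis using k by linarith
        qed
        moreover have "good_cell M s (ifs_map r b i 0) (r i) (m i) (ifs_map r b i x)" if "x \<in> space M" for x
          using image[OF unit] that by (simp add: sp)
        ultimately show ?thesis using False by (intro AE_I2) (metis less_imp_le not_le)
      qed
    qed
  qed
qed

lemma AE_good_cell:
  assumes ifs: "ifs N r b" and w: "weights N m" and M: "self_similar_measure N r b m M"
    and s: "\<And>i. i \<in> {1..N} \<Longrightarrow> (m i * r i) powr s \<le> m i"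
  obtains c where "0 < c"
    "\<And>t. 0 < t \<Longrightarrow> t \<le> 1 \<Longrightarrow>
       AE x in M. \<exists>a h p. good_cell M s a h p x \<and> c * t \<le> p * h \<and> p * h \<le> t"
proof -
  have N: "{1..N} \<noteq> {}" using ifs by (auto simp: ifs_def)
  define c where "c = Min ((\<lambda>i. m i * r i) ` {1..N})"
  define q where "q = Max ((\<lambda>i. m i * r i) ` {1..N})"
  note k = contraction_ratio_and_weight_bounds(4,5)[OF ifs w]
  have c: "c \<le> m i * r i" and q: "m i * r i \<le> q" if "i \<in> {1..N}" for i
    using that by (simp_all add: c_def q_def)
  have "c \<in> (\<lambda>i. m i * r i) ` {1..N}" "q \<in> (\<lambda>i. m i * r i) ` {1..N}"
    unfolding c_def q_def using N by (intro Min_in Max_in; simp)+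
  hence c01: "0 < c" "c \<le> 1" and q01: "q < 1" using k by (auto simp: less_imp_le)
  show thesis
  proof (rule that[OF c01(1)])
    fix t :: real assume t: "0 < t" "t \<le> 1"
    obtain n where "q ^ n < t" using real_arch_pow_inv[OF t(1) q01] by blast
    thus "AE x in M. \<exists>a h p. good_cell M s a h p x \<and> c * t \<le> p * h \<and> p * h \<le> t"
      using t by (intro AE_good_cell_power[OF ifs w M s c01(2) c q, of n]) auto
  qed
qed

text \<open>For \<open>\<gamma> \<le> 0\<close> each of the at least two summands would be at least \<open>1\<close>.\<close>

lemma spectral_exponent_pos:
  assumes "ifs N r b" "weights N m" "spectral_exponent N r m \<gamma>"
  shows "0 < \<gamma>"
proof (rule ccontr)
  assume "\<not> 0 < \<gamma>"
  have "real N = (\<Sum>i=1..N. 1)" by simp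
  also have "\<dots> \<le> (\<Sum>i=1..N. (m i * r i) powr \<gamma>)"
  proof (rule sum_mono)
    fix i assume "i \<in> {1..N}"
    note k = contraction_ratio_and_weight_bounds(4,5)[OF assms(1,2) this]
    hence "(m i * r i) powr 0 \<le> (m i * r i) powr \<gamma>"
      using \<open>\<not> 0 < \<gamma>\<close> by (intro powr_mono') auto
    thus "1 \<le> (m i * r i) powr \<gamma>" using k by (metis less_irrefl powr_zero_eq_one)
  qed
  also have "\<dots> = 1" using assms(3) by (simp add: spectral_exponent_def)
  finally show False using assms(1) by (simp add: ifs_def)
qed

text \<open>The exponent \<open>\<delta>\<close> enters through this inequality only. The logarithm of \<open>m i * r i\<close> is negative, hence
  the maximum over \<open>i\<close> in its definition.\<close>

lemma powr_growth_exponent_le_weight: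
  assumes "ifs N r b" "weights N m" "spectral_exponent N r m \<gamma>" and i: "i \<in> {1..N}"
  shows "(m i * r i) powr (\<gamma> * growth_exponent N r m \<gamma>) \<le> m i"
proof -
  define \<delta> where "\<delta> = growth_exponent N r m \<gamma>"
  have \<gamma>: "0 < \<gamma>" by (rule spectral_exponent_pos[OF assms(1-3)])
  note k = contraction_ratio_and_weight_bounds(2,4,5)[OF assms(1,2) i]
  have "ln (m i) / ln ((m i * r i) powr \<gamma>) \<le> \<delta>"
    unfolding \<delta>_def growth_exponent_def using i by (intro Max_ge) auto
  moreover have L: "ln ((m i * r i) powr \<gamma>) = \<gamma> * ln (m i * r i)" using k by (simp add: ln_powr)
  moreover have "\<gamma> * ln (m i * r i) < 0" using \<gamma> k by (simp add: mult_pos_neg ln_less_zero)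
  ultimately have "\<delta> * (\<gamma> * ln (m i * r i)) \<le> ln (m i)" by (simp add: neg_divide_le_eq)
  hence "exp ((\<gamma> * \<delta>) * ln (m i * r i)) \<le> exp (ln (m i))" by (simp add: ac_simps)
  thus ?thesis using k by (simp add: powr_def \<delta>_def)
qed

section \<open>Supremum bounds for eigenfunctions\<close>

text \<open>If some eigenvalue is not positive, the Hoelder estimate makes the eigenfunctions up to it constant.
  A Dirichlet condition forces the constant to be zero, and there cannot be two orthonormal
  constants in the Neumann case.\<close>

lemma eigenvalue_pos:
  assumes M: "sets M = sets (restrict_space borel {0..1})" "prob_space M"
    and eb: "eigenbasis M bc l \<phi>" and k: "1 \<le> k" "\<not> (bc = Neumann \<and> k = 1)"
  shows "0 < l k"
proof (rule ccontr)
  interpret prob_space M by fact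
  have sp: "space M = {0..1}" by (rule space_if_sets_unit_interval[OF M(1)])
  have ortho: "inner_L2 M (\<phi> i) (\<phi> j) = (if i = j then 1 else 0)" if "1 \<le> i" "1 \<le> j" for i j
    using eb that by (simp add: eigenbasis_def orthonormal_basis_def)
  have eig: "eigenfunction M bc (l j) (\<phi> j)" if "1 \<le> j" for j
    using eb that by (simp add: eigenbasis_def)
  assume "\<not> 0 < l k"
  hence const: "\<exists>a. (AE x in M. \<phi> j x = a) \<and> (bc = Dirichlet \<longrightarrow> a = 0)" if j: "1 \<le> j" "j \<le> k" for j
  proof -
    have "l j \<le> l k" using eb j by (simp add: eigenbasis_def)
    hence "l j \<le> 0" using \<open>\<not> 0 < l k\<close> by simp
    obtain f where f: "continuous_on {0..1} f" "AE x in M. \<phi> j x = f x" "0 \<le> l j"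
      "\<And>x y. x \<in> {0..1} \<Longrightarrow> y \<in> {0..1} \<Longrightarrow> (f x - f y)\<^sup>2 \<le> l j * \<bar>x - y\<bar>"
      "bc = Dirichlet \<Longrightarrow> f 0 = 0"
      by (rule eigenfunction_representative[OF M(1) finite_measure_axioms eig[OF j(1)]])
         (use ortho[OF j(1) j(1)] in simp, rule that)
    have f0: "f x = f 0" if "x \<in> {0..1}" for x
    proof -
      have "(f x - f 0)\<^sup>2 \<le> l j * \<bar>x - 0\<bar>" using f(4)[of x 0] that by simp
      also have "\<dots> \<le> 0" using \<open>l j \<le> 0\<close> by (intro mult_nonpos_nonneg) auto
      finally show ?thesis by simp
    qed
    have "AE x in M. \<phi> j x = f 0" using f(2) AE_space
      by eventually_elim (metis f0 sp)
    thus ?thesis using f(5) by blast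
  qed
  have inner: "inner_L2 M (\<phi> i) (\<phi> j) = a * c"
    if "1 \<le> i" "1 \<le> j" "AE x in M. \<phi> i x = a" "AE x in M. \<phi> j x = c" for i j a c
  proof -
    have [measurable]: "\<phi> i \<in> borel_measurable M" "\<phi> j \<in> borel_measurable M"
      using eb that by (auto simp: eigenbasis_def orthonormal_basis_def L2_def)
    have "inner_L2 M (\<phi> i) (\<phi> j) = (LINT x|M. a * c)"
      unfolding inner_L2_def
      by (rule integral_cong_AE; (measurable; fail)?) (use that(3,4) in \<open>eventually_elim, simp\<close>)
    thus ?thesis by (simp add: prob_space)
  qed
  obtain a where a: "AE x in M. \<phi> k x = a" "bc = Dirichlet \<Longrightarrow> a = 0" using const[of k] k by auto
  have aa: "a * a = 1" using inner[OF k(1) k(1) a(1) a(1)] ortho[OF k(1) k(1)] by simp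
  show False
  proof (cases bc)
    case Dirichlet
    thus False using a(2) aa by simp
  next
    case Neumann
    hence "k \<noteq> 1" using k by simp
    obtain c where c: "AE x in M. \<phi> 1 x = c" using const[of 1] k by auto
    have "a * c = 0" "c * c = 1"
      using inner[OF k(1) _ a(1) c] inner[OF _ _ c c] ortho[OF k(1), of 1] ortho[of 1 1] \<open>k \<noteq> 1\<close> by simp_all
    thus False using aa by (metis mult_eq_0_iff zero_neq_one)
  qed
qed

text \<open>On the cell around \<open>x\<close> the function differs from \<open>f x\<close> by at most \<open>sqrt (l * h)\<close>, and
  \<open>l * h \<le> 1 / p\<close> on the chosen scale. So a value with square far above \<open>1 / p\<close> persists on
  the whole cell, which has measure at least \<open>p\<close> and would carry more than the total square
  integral. Averaging \<open>(f x)\<^sup>2 \<le> 2 (f x - f y)\<^sup>2 + 2 (f y)\<^sup>2\<close> over the cell makes this precise.\<close>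

lemma square_le_if_good_cell:
  assumes M: "sets M = sets (restrict_space borel {0..1})" "finite_measure M"
    and f: "continuous_on {0..1} f" "(LINT y|M. (f y)\<^sup>2) \<le> 1" "0 \<le> l"
    and holder: "\<And>x y. x \<in> {0..1} \<Longrightarrow> y \<in> {0..1} \<Longrightarrow> (f x - f y)\<^sup>2 \<le> l * \<bar>x - y\<bar>"
    and cell: "good_cell M s a h p x" and ph: "l * (p * h) \<le> 1"
  shows "(f x)\<^sup>2 \<le> 4 / p"
proof -
  interpret finite_measure M by fact
  note c = cell[unfolded good_cell_def]
  define J where "J = {a..a+h}"
  have J: "J \<in> sets M" "J \<subseteq> {0..1}" using c by (auto simp: J_def M(1) sets_restrict_space_iff)
  have [measurable]: "f \<in> borel_measurable M" by (rule measurable_if_continuous_on_unit_interval[OF M(1) f(1)])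
  have sp: "space M = {0..1}" by (rule space_if_sets_unit_interval[OF M(1)])
  obtain C where C: "\<And>x. x \<in> {0..1} \<Longrightarrow> \<bar>f x\<bar> \<le> C"
    using continuous_on_unit_interval_bounded[OF f(1)] by blast
  have int: "integrable M (\<lambda>y. (f y)\<^sup>2)"
  proof (rule integrable_const_bound[of _ "C\<^sup>2"])
    show "AE y in M. norm ((f y)\<^sup>2) \<le> C\<^sup>2"
    proof (rule AE_I2)
      fix y assume "y \<in> space M"
      hence "\<bar>f y\<bar> ^ 2 \<le> C ^ 2" using C by (intro power_mono) (auto simp: sp)
      thus "norm ((f y)\<^sup>2) \<le> C\<^sup>2" by simp
    qed
  qed measurable
  have near: "(f x)\<^sup>2 - 2 * (l * h) \<le> 2 * (f y)\<^sup>2" if y: "y \<in> J" for y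
  proof -
    have "(f x - f y)\<^sup>2 \<le> l * \<bar>x - y\<bar>" using holder J(2) c y unfolding J_def by blast
    also have "\<dots> \<le> l * h" using c y f(3) by (intro mult_left_mono) (auto simp: J_def)
    finally have "(f x - f y)\<^sup>2 \<le> l * h" .
    moreover have "(f x)\<^sup>2 \<le> 2 * (f x - f y)\<^sup>2 + 2 * (f y)\<^sup>2"
      using zero_le_power2[of "f x - 2 * f y"] by (simp add: power2_eq_square algebra_simps)
    ultimately show ?thesis by linarith
  qed
  have "((f x)\<^sup>2 - 2 * (l * h)) * measure M J = (LINT y|M. indicator J y * ((f x)\<^sup>2 - 2 * (l * h)))"
    using J(1) by simp
  also have "\<dots> \<le> (LINT y|M. 2 * (f y)\<^sup>2)"
  proof (rule integral_mono_AE)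
    show "integrable M (\<lambda>y. indicator J y * ((f x)\<^sup>2 - 2 * (l * h)))"
      using J(1) by (intro integrable_mult_left integrable_real_indicator) (auto simp: less_top[symmetric])
    show "AE y in M. indicator J y * ((f x)\<^sup>2 - 2 * (l * h)) \<le> 2 * (f y)\<^sup>2"
      using near by (intro AE_I2) (simp add: indicator_def)
  qed (use int in simp)
  also have "\<dots> \<le> 2" using f(2) by simp
  finally have le: "((f x)\<^sup>2 - 2 * (l * h)) * measure M J \<le> 2" .
  have "((f x)\<^sup>2 - 2 * (l * h)) * p \<le> 2"
  proof (cases "0 \<le> (f x)\<^sup>2 - 2 * (l * h)")
    case True
    hence "((f x)\<^sup>2 - 2 * (l * h)) * p \<le> ((f x)\<^sup>2 - 2 * (l * h)) * measure M J"
      using c by (intro mult_left_mono) (auto simp: J_def)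
    thus ?thesis using le by linarith
  next
    case False
    hence "((f x)\<^sup>2 - 2 * (l * h)) * p \<le> 0" using c by (intro mult_nonpos_nonneg) auto
    thus ?thesis by linarith
  qed
  hence "(f x)\<^sup>2 * p \<le> 4" using ph by (simp add: algebra_simps)
  thus ?thesis using c by (simp add: field_simps)
qed

theorem theorem2p1:
  fixes N :: nat and r b m :: "nat \<Rightarrow> real" and M :: "real measure" and \<gamma> \<delta> :: real
    and bc :: bdry and l :: "nat \<Rightarrow> real" and \<phi> :: "nat \<Rightarrow> real \<Rightarrow> real"
  assumes "ifs N r b"
    and "weights N m"
    and "self_similar_measure N r b m M"
    and "spectral_exponent N r m \<gamma>"
    and "\<delta> = growth_exponent N r m \<gamma>"
    and "eigenbasis M bc l \<phi>"
  shows "\<exists>C>0. \<forall>k\<ge>1. \<not> (bc = Neumann \<and> k = 1) \<longrightarrow>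
           sup_norm M (\<phi> k) \<le> ereal (C * l k powr (\<gamma> / 2 * \<delta>))"
proof -
  have M: "sets M = sets (restrict_space borel {0..1})" "prob_space M"
    using assms(3) by (auto simp: self_similar_measure_def)
  interpret prob_space M by fact
  have sp: "space M = {0..1}" by (rule space_if_sets_unit_interval[OF M(1)])
  define s where "s = \<gamma> * \<delta>"
  have s: "(m i * r i) powr s \<le> m i" if "i \<in> {1..N}" for i
    using powr_growth_exponent_le_weight[OF assms(1,2,4) that] by (simp add: s_def assms(5))
  \<comment> \<open>A number in \<open>(0,1)\<close> has a power below one only if the exponent is positive.\<close>
  have s0: "0 < s"
  proof (rule ccontr)
    assume "\<not> 0 < s"
    have i: "1 \<in> {1..N}" using assms(1) by (simp add: ifs_def)
    note k = contraction_ratio_and_weight_bounds[OF assms(1,2) i]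
    have "(m 1 * r 1) powr 0 \<le> (m 1 * r 1) powr s"
      using k(4,5) \<open>\<not> 0 < s\<close> by (intro powr_mono') auto
    hence "1 \<le> (m 1 * r 1) powr s" using k(4) by (metis less_irrefl powr_zero_eq_one)
    thus False using s[OF i] k(3) by linarith
  qed
  obtain c where c: "0 < c" "\<And>t. 0 < t \<Longrightarrow> t \<le> 1 \<Longrightarrow>
       AE x in M. \<exists>a h p. good_cell M s a h p x \<and> c * t \<le> p * h \<and> p * h \<le> t"
    using AE_good_cell[OF assms(1-3) s] by blast
  \<comment> \<open>The index of the first eigenvalue covered by the claim. That eigenvalue is positive and bounds
    the later ones from below.\<close>
  define k0 where "k0 = (if bc = Neumann then 2 else 1 :: nat)"
  have k0: "0 < l k0" by (rule eigenvalue_pos[OF M assms(6)]) (auto simp: k0_def)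
  define e where "e = min 1 (l k0)"
  have e: "0 < e" "e \<le> 1" "e \<le> l k0" using k0 by (auto simp: e_def)
  define C where "C = 2 * (c * e) powr (- s / 2)"
  show ?thesis
  proof (intro exI[of _ C] conjI allI impI)
    show "0 < C" using c(1) e(1) by (simp add: C_def)
    fix k :: nat assume k: "1 \<le> k" "\<not> (bc = Neumann \<and> k = 1)"
    hence "1 \<le> k0" "k0 \<le> k" by (auto simp: k0_def)
    hence lk: "e \<le> l k" using assms(6) e(3) unfolding eigenbasis_def by force
    hence lk0: "0 < l k" using e(1) by linarith
    have eig: "eigenfunction M bc (l k) (\<phi> k)" and nrm: "inner_L2 M (\<phi> k) (\<phi> k) = 1"
      and meas[measurable]: "\<phi> k \<in> borel_measurable M"
      using assms(6) k by (auto simp: eigenbasis_def orthonormal_basis_def L2_def)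
    obtain f where f: "continuous_on {0..1} f" "AE x in M. \<phi> k x = f x" "0 \<le> l k"
      "\<And>x y. x \<in> {0..1} \<Longrightarrow> y \<in> {0..1} \<Longrightarrow> (f x - f y)\<^sup>2 \<le> l k * \<bar>x - y\<bar>"
      "bc = Dirichlet \<Longrightarrow> f 0 = 0"
      by (rule eigenfunction_representative[OF M(1) finite_measure_axioms eig nrm]) (rule that)
    have [measurable]: "f \<in> borel_measurable M"
      by (rule measurable_if_continuous_on_unit_interval[OF M(1) f(1)])
    have "(LINT y|M. (f y)\<^sup>2) = inner_L2 M (\<phi> k) (\<phi> k)"
      unfolding inner_L2_def power2_eq_square
    proof (rule integral_cong_AE)
      show "AE y in M. f y * f y = \<phi> k y * \<phi> k y" using f(2) by eventually_elim simp
    qed measurable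
    hence f1: "(LINT y|M. (f y)\<^sup>2) \<le> 1" using nrm by simp
    \<comment> \<open>The scale \<open>1 / l k\<close>, capped at \<open>1\<close> because no cell is larger than the unit interval. As
      \<open>e / l k \<le> t\<close>, it stays comparable to \<open>1 / l k\<close> for eigenvalues below \<open>1\<close> too.\<close>
    define t where "t = min 1 (1 / l k)"
    have t: "0 < t" "t \<le> 1" "l k * t \<le> 1" using lk0 by (auto simp: t_def min_def field_simps)
    have te: "e / l k \<le> t" using lk lk0 e by (auto simp: t_def divide_right_mono)
    have "AE x in M. \<bar>\<phi> k x\<bar> \<le> C * l k powr (\<gamma> / 2 * \<delta>)"
      using c(2)[OF t(1,2)] f(2)
    proof eventually_elim
      fix x
      assume cells: "\<exists>a h p. good_cell M s a h p x \<and> c * t \<le> p * h \<and> p * h \<le> t" and x: "\<phi> k x = f x"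
      obtain a h p where cell: "good_cell M s a h p x" and ph: "c * t \<le> p * h" "p * h \<le> t"
        using cells by blast
      have p: "0 < p" "(p * h) powr s \<le> p" using cell by (auto simp: good_cell_def)
      have "c * e / l k \<le> p * h"
        using ph(1) mult_left_mono[OF te, of c] c(1) by simp
      hence "(c * e / l k) powr s \<le> (p * h) powr s"
        using c(1) e(1) lk0 s0 by (intro powr_mono2) auto
      hence pge: "(c * e / l k) powr s \<le> p" using p by simp
      have pos: "0 < (c * e / l k) powr s" using c(1) e(1) lk0 by simp
      have "l k * (p * h) \<le> 1"
        using mult_left_mono[OF ph(2), of "l k"] lk0 t(3) by linarith
      hence "(f x)\<^sup>2 \<le> 4 / p"
        using square_le_if_good_cell[OF M(1) finite_measure_axioms f(1) f1 f(3,4) cell] by simp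
      also have "\<dots> \<le> 4 / (c * e / l k) powr s"
        by (rule divide_left_mono[OF pge _ mult_pos_pos[OF p(1) pos]]) simp
      also have "\<dots> = (C * l k powr (\<gamma> / 2 * \<delta>))\<^sup>2"
      proof -
        have "(C * l k powr (\<gamma> / 2 * \<delta>))\<^sup>2 = 4 * ((c * e) powr (- s / 2))\<^sup>2 * (l k powr (s / 2))\<^sup>2"
          by (simp add: C_def s_def power_mult_distrib)
        also have "\<dots> = 4 * (c * e) powr (- s) * l k powr s"
          by (simp add: power2_eq_square powr_add[symmetric])
        also have "(c * e) powr (- s) = inverse ((c * e) powr s)"
          by (rule powr_minus)
        also have "4 * inverse ((c * e) powr s) * l k powr s = 4 / ((c * e) powr s / l k powr s)"
          by (simp only: divide_inverse inverse_mult_distrib inverse_inverse_eq mult.assoc)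
        also have "(c * e) powr s / l k powr s = (c * e / l k) powr s"
          by (rule powr_divide[symmetric])
        finally show ?thesis by simp
      qed
      finally have "\<bar>f x\<bar>\<^sup>2 \<le> (C * l k powr (\<gamma> / 2 * \<delta>))\<^sup>2" by simp
      hence "\<bar>f x\<bar> \<le> C * l k powr (\<gamma> / 2 * \<delta>)"
        by (rule power2_le_imp_le) (use \<open>0 < C\<close> in simp)
      thus "\<bar>\<phi> k x\<bar> \<le> C * l k powr (\<gamma> / 2 * \<delta>)" using x by simp
    qed
    thus "sup_norm M (\<phi> k) \<le> ereal (C * l k powr (\<gamma> / 2 * \<delta>))"
      unfolding sup_norm_def by (intro esssup_I) auto
  qed
qed

end
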